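(* Let $d\geq 1$, let $(X,\mu)$ be a non-atomic probability space, and let $(U_{\boldsymbol t})_{\boldsymbol t\in\mathbb{R}^d}$ be a measurable, measure-preserving $d$-dimensional flow on $X$. Let $\{\boldsymbol w_k\}_{k\in\mathbb{N}}\subset\mathbb{R}^d$ and $\{\boldsymbol s_k\}_{k\in\mathbb{N}}\subset(0,+\infty)^d$ be sequences, and let $\mathcal{B}=\{B_k\}_{k\in\mathbb{N}}$ be the associated family of boxes, with sets $\Omega_i^{(\alpha)}(\lambda)$ and maximal operator $N_{\mathcal{B}}$ as defined in the context. Assume that for every $i=1,\dots,d$ there exist $A,\alpha>0$ (possibly depending on $i$) such that $$\mathrm{Leb}\left(\Omega_i^{(\alpha)}(\lambda)\right)\leq A\lambda\quad\text{for all }\lambda>0.$$ Then the operator $N_{\mathcal{B}}$ is of strong type $(p,p)$ for every $p>1$.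
   Context: $\mathrm{Leb}$ is Lebesgue measure on $\mathbb{R}$. A measurable, measure-preserving $d$-dimensional flow on $X$ is a jointly measurable action $(\boldsymbol t,x)\mapsto U_{\boldsymbol t}x$ of $\mathbb{R}^d$ on $X$ by $\mu$-preserving transformations. Given the sequences $\boldsymbol w_k=(w_{k1},\dots,w_{kd})$ and $\boldsymbol s_k=(s_{k1},\dots,s_{kd})$, put $$B_k:=[w_{k1},w_{k1}+s_{k1})\times\cdots\times[w_{kd},w_{kd}+s_{kd}),\qquad \mathcal{B}:=\{B_k\}.$$ The maximal operator is $$N_{\mathcal{B}}f(x):=\sup_{B_k\in\mathcal{B}}\frac{1}{s_{k1}\cdots s_{kd}}\int_{B_k}|f(U_{\boldsymbol t}x)|\,d\boldsymbol t .$$ For $i=1,\dots,d$ let $\Omega_i:=\{(w_{ki},s_{ki}):k\in\mathbb{N}\}$. For $\alpha>0$ let $$\Omega_i^{(\alpha)}:=\{(x,y)\in\mathbb{R}\times(0,+\infty): |x-t|\leq\alpha(y-s)\text{ for some }(t,s)\in\Omega_i\},$$ and for $\lambda>0$ let $\Omega_i^{(\alpha)}(\lambda):=\{x\in\mathbb{R}:(x,\lambda)\in\Omega_i^{(\alpha)}\}$. $N_{\mathcal{B}}$ is of strong type $(p,p)$ if there is a constant $C>0$ such that $\|N_{\mathcal{B}}f\|_p\leq C\|f\|_p$ for all $f\in L^p(X)$. *)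

theory Defs
  imports "HOL-Probability.Probability"
begin

definition nonatomic :: "'a measure \<Rightarrow> bool" where
  "nonatomic M \<longleftrightarrow>
     (\<forall>A\<in>sets M. 0 < emeasure M A \<longrightarrow>
        (\<exists>B\<in>sets M. B \<subseteq> A \<and> 0 < emeasure M B \<and> emeasure M B < emeasure M A))"

definition measure_preserving_flow :: "'a measure \<Rightarrow> (real^'d \<Rightarrow> 'a \<Rightarrow> 'a) \<Rightarrow> bool" where
  "measure_preserving_flow M U \<longleftrightarrow>
     (\<lambda>(t, x). U t x) \<in> measurable (borel \<Otimes>\<^sub>M M) M \<and>
     (\<forall>x\<in>space M. U 0 x = x) \<and>
     (\<forall>s t. \<forall>x\<in>space M. U (s + t) x = U s (U t x)) \<and>
     (\<forall>t. U t \<in> measurable M M \<and> distr M M (U t) = M)"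

definition half_open_box :: "real^'d \<Rightarrow> real^'d \<Rightarrow> (real^'d) set" where
  "half_open_box w s = {t. \<forall>i. t $ i \<in> {w $ i ..< w $ i + s $ i}}"

(* The supremum may be infinite at some points, so the operator takes values in ennreal. *)
definition maximal_op ::
  "(real^'d \<Rightarrow> 'a \<Rightarrow> 'a) \<Rightarrow> (nat \<Rightarrow> real^'d) \<Rightarrow> (nat \<Rightarrow> real^'d) \<Rightarrow> ('a \<Rightarrow> real) \<Rightarrow> 'a \<Rightarrow> ennreal" where
  "maximal_op U w s f x =
     (SUP k. ennreal (1 / (\<Prod>i\<in>UNIV. s k $ i)) *
        (\<integral>\<^sup>+ t \<in> half_open_box (w k) (s k). ennreal \<bar>f (U t x)\<bar> \<partial>lborel))"

definition Omega :: "(nat \<Rightarrow> real^'d) \<Rightarrow> (nat \<Rightarrow> real^'d) \<Rightarrow> 'd \<Rightarrow> (real \<times> real) set" where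
  "Omega w s i = {(w k $ i, s k $ i) | k. True}"

definition Omega_cone :: "real \<Rightarrow> (real \<times> real) set \<Rightarrow> (real \<times> real) set" where
  "Omega_cone \<alpha> S = {(x, y). 0 < y \<and> (\<exists>(t, v)\<in>S. \<bar>x - t\<bar> \<le> \<alpha> * (y - v))}"

definition cross_section :: "(real \<times> real) set \<Rightarrow> real \<Rightarrow> real set" where
  "cross_section S l = {x. (x, l) \<in> S}"

(* Real powers on [0, \<infinity>], with \<infinity> ^ p = \<infinity>; used for p > 0 only. *)
definition ennreal_powr :: "ennreal \<Rightarrow> real \<Rightarrow> ennreal" where
  "ennreal_powr a p = (if a = \<infinity> then \<infinity> else ennreal (enn2real a powr p))"

definition Lp_norm :: "'a measure \<Rightarrow> real \<Rightarrow> ('a \<Rightarrow> ennreal) \<Rightarrow> ennreal" where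
  "Lp_norm M p g = ennreal_powr (\<integral>\<^sup>+ x. ennreal_powr (g x) p \<partial>M) (1 / p)"

definition Lp_space :: "'a measure \<Rightarrow> real \<Rightarrow> ('a \<Rightarrow> real) set" where
  "Lp_space M p = {f \<in> borel_measurable M. Lp_norm M p (\<lambda>x. ennreal \<bar>f x\<bar>) < \<infinity>}"

(* Measurability of T f is demanded because nn_integral is only a lower integral on
   non-measurable functions, where Lp_norm would not be the L^p norm. *)
definition strong_type ::
  "'a measure \<Rightarrow> (('a \<Rightarrow> real) \<Rightarrow> 'a \<Rightarrow> ennreal) \<Rightarrow> real \<Rightarrow> bool" where
  "strong_type M T p \<longleftrightarrow>
     (\<exists>C>0. \<forall>f\<in>Lp_space M p. T f \<in> borel_measurable M \<and>
        Lp_norm M p (T f) \<le> ennreal C * Lp_norm M p (\<lambda>x. ennreal \<bar>f x\<bar>))"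

end

theory Submission
  imports Defs
begin

text \<open>
  The cone condition is the Nagel-Stein condition on an approach region, so the theorem is their
  maximal theorem carried over to a flow and iterated over the coordinates.

  \<^bold>\<open>On the line.\<close>  Fix one coordinate and let \<open>F \<ge> 0\<close> be integrable on the line.  A point \<open>x\<close> is bad at level
  \<open>l\<close> if \<open>F\<close> has average above \<open>l\<close> on some interval \<open>[x + t\<^sub>k, x + t\<^sub>k + v\<^sub>k)\<close>.  The lengths of such
  intervals are bounded by \<open>\<integral>F / l\<close>, so the Vitali covering lemma selects disjoint ones, with left
  endpoints \<open>a\<^sub>j\<close> and lengths \<open>v\<^sub>j\<close>, such that each bad interval lies in the fivefold enlargement of a
  selected one.  If the interval of \<open>x\<close> is swallowed by the \<open>j\<close>-th, then \<open>a\<^sub>j - x\<close> differs from \<open>t\<^sub>k\<close> by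
  at most \<open>3 v\<^sub>j\<close>, hence lies in the section of the cone region at a height \<open>L\<^sub>j\<close> proportional to \<open>v\<^sub>j\<close>.
  The hypothesis bounds the measure of the set of these \<open>x\<close> by a multiple of \<open>v\<^sub>j\<close>, and
  \<open>\<Sum>\<^sub>j v\<^sub>j \<le> \<integral>F / l\<close> by disjointness.  This is the weak type (1,1) inequality
  \<open>weak_type_translation\<close>.

  \<^bold>\<open>On the space.\<close>  Finitely many averages at the points of an orbit segment of length \<open>R\<close> see only
  a segment of length \<open>3 R\<close>, if \<open>R\<close> is large enough.  Applying the inequality on the line along each
  orbit and integrating over the space yields the weak type inequality for the flow
  (\<open>weak_type_flow\<close>), with a constant that does not depend on how many averages were taken.
  The maximal operator is trivially bounded on \<open>L\<^sup>\<infinity>\<close>, and interpolating as Marcinkiewicz did gives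
  the strong type \<open>(p, p)\<close> for \<open>p > 1\<close> (\<open>strong_type_flow\<close>).

  \<^bold>\<open>In several dimensions.\<close>  The average over a box is an iterated average along the coordinate
  axes.  Replacing each of these by the supremum over its own index, independently of the others,
  bounds the operator by a composition of the one-dimensional maximal operators
  (\<open>iterated_average_dominated\<close>), each of which is bounded on \<open>L\<^sup>p\<close>.  The one-dimensional theory is
  developed for functions with values in \<open>[0, \<infinity>]\<close>, because the maximal functions that are fed into
  the next operator may be infinite at some points.
\<close>

section \<open>Powers and layers of extended nonnegative reals\<close>

lemma ennreal_powr_ennreal: "0 \<le> a \<Longrightarrow> ennreal_powr (ennreal a) p = ennreal (a powr p)"
  unfolding ennreal_powr_def by simp

lemma ennreal_powr_top [simp]: "ennreal_powr \<top> p = \<top>"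
  unfolding ennreal_powr_def by simp

lemma ennreal_powr_mono: "0 < p \<Longrightarrow> a \<le> b \<Longrightarrow> ennreal_powr a p \<le> ennreal_powr b p"
  by (cases a; cases b)
     (auto simp: ennreal_powr_ennreal top_unique intro!: ennreal_leI powr_mono2)

lemma ennreal_powr_mult:
  assumes "0 < c" "0 < p"
  shows "ennreal_powr (ennreal c * a) p = ennreal (c powr p) * ennreal_powr a p"
  using assms by (cases a)
    (auto simp: ennreal_powr_ennreal ennreal_mult[symmetric] powr_mult ennreal_mult_top)

lemma measurable_ennreal_powr [measurable]:
  assumes [measurable]: "f \<in> borel_measurable M"
  shows "(\<lambda>x. ennreal_powr (f x) p) \<in> borel_measurable M"
  unfolding ennreal_powr_def by measurable

lemma ennreal_inverse_mult_cancel: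
  assumes "0 < (c::real)"
  shows "ennreal (1 / c) * (ennreal c * a) = a"
proof -
  have "ennreal (1 / c) * ennreal c = 1"
    using assms by (simp add: ennreal_mult[symmetric])
  then show ?thesis by (simp add: mult.assoc[symmetric])
qed

lemma less_inverse_mult_iff:
  assumes "0 < (v::real)" "0 \<le> l"
  shows "ennreal l < ennreal (1 / v) * I \<longleftrightarrow> ennreal (l * v) < I"
proof (cases I)
  case (real r)
  then show ?thesis using assms
    by (simp add: ennreal_mult[symmetric] ennreal_less_iff pos_less_divide_eq)
next
  case top
  then show ?thesis using assms by (simp add: ennreal_mult_top)
qed

lemma layer_cake_finite:
  assumes "0 < q" "0 \<le> a"
  shows "(\<integral>\<^sup>+ l \<in> {l. 0 < l \<and> ennreal l < ennreal a}. ennreal (l powr (q - 1)) \<partial>lborel)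
    = ennreal (a powr q / q)"
proof -
  have "(\<integral>\<^sup>+ l \<in> {l. 0 < l \<and> ennreal l < ennreal a}. ennreal (l powr (q - 1)) \<partial>lborel)
     = (\<integral>\<^sup>+ l \<in> {0..a}. ennreal (l powr (q - 1)) \<partial>lborel)"
  proof (rule nn_integral_cong_AE)
    have "AE l in lborel. l \<noteq> a" "AE l in lborel. l \<noteq> (0::real)"
      by (auto intro: AE_lborel_singleton)
    then show "AE l in lborel. ennreal (l powr (q - 1)) * indicator {l. 0 < l \<and> ennreal l < ennreal a} l
       = ennreal (l powr (q - 1)) * indicator {0..a} l"
      by eventually_elim (auto simp: indicator_def ennreal_less_iff)
  qed
  also have "\<dots> = ennreal (a powr (q - 1 + 1) / (q - 1 + 1))"
    using assms by (intro nn_integral_has_integral_lebesgue' has_integral_powr_from_0) auto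
  finally show ?thesis by simp
qed

text \<open>
  At \<open>a = \<infinity>\<close> the left-hand side dominates its values at all finite \<open>a\<close>, and these are unbounded.
\<close>
lemma layer_cake:
  assumes "0 < q"
  shows "ennreal q * (\<integral>\<^sup>+ l \<in> {l. 0 < l \<and> ennreal l < a}. ennreal (l powr (q - 1)) \<partial>lborel)
    = ennreal_powr a q"
proof (cases a)
  case (real r)
  have "ennreal q * ennreal (r powr q / q) = ennreal (r powr q)"
    using assms by (simp add: ennreal_mult[symmetric])
  then show ?thesis
    unfolding real(2) layer_cake_finite[OF assms real(1)] ennreal_powr_ennreal[OF real(1)] .
next
  case top
  let ?I = "\<integral>\<^sup>+ l \<in> {l. 0 < l \<and> ennreal l < a}. ennreal (l powr (q - 1)) \<partial>lborel"
  have le: "ennreal y \<le> ennreal q * ?I" if "0 \<le> y" for y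
  proof -
    let ?b = "y powr (1 / q)"
    have "ennreal q * ennreal (?b powr q / q) = ennreal (q * (?b powr q / q))"
      using assms by (intro ennreal_mult[symmetric]) auto
    also have "q * (?b powr q / q) = y" using assms that by (simp add: powr_powr)
    finally have y: "ennreal y = ennreal q * ennreal (?b powr q / q)" by (rule sym)
    have "ennreal (?b powr q / q) \<le> ?I"
    proof -
      have "ennreal (?b powr q / q)
          = (\<integral>\<^sup>+ l \<in> {l. 0 < l \<and> ennreal l < ennreal ?b}. ennreal (l powr (q - 1)) \<partial>lborel)"
        using assms by (intro layer_cake_finite[symmetric]) auto
      also have "\<dots> \<le> ?I"
        unfolding top by (intro nn_integral_mono) (simp add: indicator_def)
      finally show ?thesis .
    qed
    then show ?thesis unfolding y by (intro mult_left_mono) auto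
  qed
  have "ennreal q * ?I = \<top>"
  proof (rule ccontr)
    assume "ennreal q * ?I \<noteq> \<top>"
    then obtain r where r: "0 \<le> r" "ennreal q * ?I = ennreal r" by (cases "ennreal q * ?I") auto
    have "ennreal (r + 1) \<le> ennreal r" using le[of "r + 1"] r(1) unfolding r(2) by simp
    then show False using r(1) by simp
  qed
  then show ?thesis using top by simp
qed

text \<open>
  The inner integral of the interpolation argument: the layers \<open>l < 2 a\<close>, with weight \<open>l powr (p - 2)\<close>,
  contribute a multiple of \<open>a powr (p - 1)\<close>.  The weight is integrable at \<open>0\<close> precisely because
  \<open>p > 1\<close>.
\<close>
lemma truncated_layers_le:
  fixes a :: ennreal
  assumes p: "1 < p"
  shows "(\<integral>\<^sup>+ l. ennreal (l powr (p - 2)) * indicator {0<..} l * (a * of_bool (ennreal (l / 2) < a)) \<partial>lborel)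
    \<le> ennreal (2 powr (p - 1) / (p - 1)) * ennreal_powr a p"
proof -
  let ?L = "\<integral>\<^sup>+ l \<in> {l. 0 < l \<and> ennreal l < ennreal 2 * a}. ennreal (l powr ((p - 1) - 1)) \<partial>lborel"
  have "(\<integral>\<^sup>+ l. ennreal (l powr (p - 2)) * indicator {0<..} l * (a * of_bool (ennreal (l / 2) < a)) \<partial>lborel)
     = (\<integral>\<^sup>+ l. a * (ennreal (l powr ((p - 1) - 1)) * indicator {l. 0 < l \<and> ennreal l < ennreal 2 * a} l) \<partial>lborel)"
  proof (intro nn_integral_cong)
    fix l :: real
    have iff: "ennreal (l / 2) < a \<longleftrightarrow> ennreal l < ennreal 2 * a" if "0 < l"
      using less_inverse_mult_iff[of "1 / 2" l a] that by simp
    have "p - 1 - 1 = p - 2" by simp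
    then show "ennreal (l powr (p - 2)) * indicator {0<..} l * (a * of_bool (ennreal (l / 2) < a))
      = a * (ennreal (l powr ((p - 1) - 1)) * indicator {l. 0 < l \<and> ennreal l < ennreal 2 * a} l)"
      using iff by (cases "0 < l") (simp_all add: indicator_def mult.commute mult.left_commute)
  qed
  also have "\<dots> = a * ?L"
    by (intro nn_integral_cmult) (simp add: indicator_def)
  also have "?L = ennreal (1 / (p - 1)) * ennreal_powr (ennreal 2 * a) (p - 1)"
  proof -
    have "?L = ennreal (1 / (p - 1)) * (ennreal (p - 1) * ?L)"
      using p by (intro ennreal_inverse_mult_cancel[symmetric]) simp
    also have "ennreal (p - 1) * ?L = ennreal_powr (ennreal 2 * a) (p - 1)"
      using p by (intro layer_cake) simp
    finally show ?thesis .
  qed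
  also have "a * (ennreal (1 / (p - 1)) * ennreal_powr (ennreal 2 * a) (p - 1))
      \<le> ennreal (2 powr (p - 1) / (p - 1)) * ennreal_powr a p"
  proof (cases a)
    case (real r)
    have r: "r * r powr (p - 1) = r powr p"
      using real powr_mult_base[of r "p - 1"] by (cases "r = 0") auto
    have "a * (ennreal (1 / (p - 1)) * ennreal_powr (ennreal 2 * a) (p - 1))
        = ennreal (r * (1 / (p - 1) * (2 powr (p - 1) * r powr (p - 1))))"
    proof -
      have "ennreal_powr (ennreal 2 * a) (p - 1) = ennreal (2 powr (p - 1) * r powr (p - 1))"
        using p real ennreal_powr_mult[of 2 "p - 1" a]
        by (simp only: ennreal_powr_ennreal) (simp add: ennreal_mult)
      then show ?thesis
        using p real by (simp add: ennreal_mult[symmetric])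
    qed
    also have "r * (1 / (p - 1) * (2 powr (p - 1) * r powr (p - 1))) = 2 powr (p - 1) / (p - 1) * r powr p"
      unfolding r[symmetric] by simp
    also have "ennreal \<dots> = ennreal (2 powr (p - 1) / (p - 1)) * ennreal_powr a p"
      using p real by (simp add: ennreal_powr_ennreal ennreal_mult del: times_divide_eq_left)
    finally show ?thesis by simp
  next
    case top
    then show ?thesis using p by (simp add: ennreal_mult_top)
  qed
  finally show ?thesis .
qed

section \<open>The weak type inequality on the line\<close>

text \<open>
  The family of maps \<open>V\<close> is a parameter so that the same operator serves for the translations of the
  line and for the orbits of a flow.
\<close>
definition line_maximal ::
  "(real \<Rightarrow> 'a \<Rightarrow> 'a) \<Rightarrow> (nat \<Rightarrow> real) \<Rightarrow> (nat \<Rightarrow> real) \<Rightarrow> ('a \<Rightarrow> ennreal) \<Rightarrow> 'a \<Rightarrow> ennreal" where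
  "line_maximal V t v g x =
     (SUP k. ennreal (1 / v k) * (\<integral>\<^sup>+ \<tau> \<in> {t k ..< t k + v k}. g (V \<tau> x) \<partial>lborel))"

lemma less_line_maximal_iff:
  assumes "\<And>k. 0 < v k" "0 \<le> l"
  shows "ennreal l < line_maximal V t v g x \<longleftrightarrow>
    (\<exists>k. ennreal (l * v k) < (\<integral>\<^sup>+ \<tau> \<in> {t k ..< t k + v k}. g (V \<tau> x) \<partial>lborel))"
  unfolding line_maximal_def less_SUP_iff using assms by (simp add: less_inverse_mult_iff)

lemma nn_integral_translate_interval:
  fixes F :: "real \<Rightarrow> ennreal"
  assumes [measurable]: "F \<in> borel_measurable borel"
  shows "(\<integral>\<^sup>+ \<tau> \<in> {a ..< b}. F (x + \<tau>) \<partial>lborel) = (\<integral>\<^sup>+ y \<in> {x + a ..< x + b}. F y \<partial>lborel)"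
  by (subst (2) nn_integral_real_affine[where t = x and c = 1])
     (auto intro!: nn_integral_cong simp: indicator_def)

locale approach_region =
  fixes t v :: "nat \<Rightarrow> real" and A \<alpha> :: real
  assumes v_pos: "\<And>k. 0 < v k"
    and A_pos: "0 < A" and \<alpha>_pos: "0 < \<alpha>"
    and thin: "\<And>l. 0 < l \<Longrightarrow>
      emeasure lborel (cross_section (Omega_cone \<alpha> (range (\<lambda>k. (t k, v k)))) l) \<le> ennreal (A * l)"
begin

abbreviation section_at :: "real \<Rightarrow> real set" where
  "section_at \<equiv> cross_section (Omega_cone \<alpha> (range (\<lambda>k. (t k, v k))))"

text \<open>
  At height \<open>(5 + 3 / \<alpha>) * v\<close> the cone over \<open>(t\<^sub>k, v\<^sub>k)\<close> contains all points within distance \<open>3 v\<close> of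
  \<open>t\<^sub>k\<close>, for every \<open>k\<close> with \<open>v\<^sub>k \<le> 5 v\<close>.  The hypothesis at this height gives the constant.
\<close>
definition weak_const :: real where
  "weak_const = A * (5 + 3 / \<alpha>)"

lemma weak_const_pos: "0 < weak_const"
  unfolding weak_const_def using A_pos \<alpha>_pos by (simp add: add_pos_pos)

lemma mem_section_at: "x \<in> section_at l \<longleftrightarrow> 0 < l \<and> (\<exists>k. \<bar>x - t k\<bar> \<le> \<alpha> * (l - v k))"
  unfolding cross_section_def Omega_cone_def by auto

text \<open>
  A section at a positive height is a countable union of compact intervals.
\<close>
lemma sets_section_at [measurable]: "section_at l \<in> sets borel"
proof (cases "0 < l")
  case True
  then have "section_at l = (\<Union>k. {t k - \<alpha> * (l - v k) .. t k + \<alpha> * (l - v k)})"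
    by (simp add: set_eq_iff mem_section_at abs_le_iff) (simp add: algebra_simps conj_commute)
  then show ?thesis by simp
next
  case False
  then have "section_at l = {}" by (auto simp: mem_section_at)
  then show ?thesis by simp
qed

lemma emeasure_reflected_section:
  assumes "0 < l"
  shows "emeasure lborel {x. a - x \<in> section_at l} \<le> ennreal (A * l)"
proof -
  have "emeasure lborel {x. a - x \<in> section_at l}
      = (\<integral>\<^sup>+ x. indicator (section_at l) (a - x) \<partial>lborel)"
  proof -
    have "(\<lambda>x. indicator (section_at l) (a - x) :: ennreal) = indicator {x. a - x \<in> section_at l}"
      by (auto simp: indicator_def)
    then show ?thesis by simp
  qed
  also have "\<dots> = (\<integral>\<^sup>+ x. indicator (section_at l) x \<partial>lborel)"
    by (subst (2) nn_integral_real_affine[where t = a and c = "-1"]) auto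
  also have "\<dots> = emeasure lborel (section_at l)" by simp
  finally show ?thesis using thin[OF assms] by simp
qed

text \<open>
  The Vitali argument of Nagel and Stein.  Bad intervals are indexed by pairs \<open>(x, k)\<close> in \<open>K\<close>, so that
  the bad points are the first components.  Each selected interval \<open>J\<close> accounts for the points in
  its shadow \<open>P\<close>, the reflected section at height \<open>L\<close>, whose measure the hypothesis compares to the
  length of \<open>J\<close>, and hence to the mass of \<open>F\<close> on \<open>J\<close>.
\<close>
lemma weak_type_translation:
  fixes F :: "real \<Rightarrow> ennreal"
  assumes F [measurable]: "F \<in> borel_measurable borel" and l: "0 < l"
  shows "emeasure lborel {x. ennreal l < line_maximal (\<lambda>\<tau> x. x + \<tau>) t v F x}
    \<le> ennreal (weak_const / l) * (\<integral>\<^sup>+ y. F y \<partial>lborel)"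
proof (cases "(\<integral>\<^sup>+ y. F y \<partial>lborel)")
  case top
  then show ?thesis using l weak_const_pos by (simp add: ennreal_mult_top)
next
  case (real S)
  define K where "K = {(x, k). ennreal (l * v k) <
     (\<integral>\<^sup>+ y \<in> {x + t k ..< x + t k + v k}. F y \<partial>lborel)}"
  define c where "c = (\<lambda>(x, k). x + t k + v k / 2)"
  define r where "r = (\<lambda>(x::real, k). v k / 2)"
  have E_eq: "{x. ennreal l < line_maximal (\<lambda>\<tau> x. x + \<tau>) t v F x} = fst ` K"
    using v_pos l
    by (auto simp: less_line_maximal_iff K_def nn_integral_translate_interval add.assoc image_iff)
  \<comment> \<open>Bad intervals cannot be long, as the total mass of \<open>F\<close> is finite; this lets the covering lemma apply to all of them at once.\<close>
  have r_bound: "0 < r j \<and> r j \<le> S / l" if "j \<in> K" for j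
  proof -
    obtain x k where j: "j = (x, k)" by (cases j)
    have "ennreal (l * v k) \<le> (\<integral>\<^sup>+ y \<in> {x + t k ..< x + t k + v k}. F y \<partial>lborel)"
      using that by (simp add: K_def j)
    also have "\<dots> \<le> (\<integral>\<^sup>+ y. F y \<partial>lborel)"
      by (intro nn_integral_mono) (auto simp: indicator_def)
    finally have "l * v k \<le> S" using real by simp
    then show ?thesis using v_pos[of k] l
      by (simp add: j r_def field_simps) (smt (verit) mult_pos_pos)
  qed
  obtain C where C: "countable C" "C \<subseteq> K"
    and disj: "pairwise (\<lambda>i j. disjnt (cball (c i) (r i)) (cball (c j) (r j))) C"
    and cover: "\<And>i. i \<in> K \<Longrightarrow> \<exists>j. j \<in> C \<and> \<not> disjnt (cball (c i) (r i)) (cball (c j) (r j)) \<and>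
                   cball (c i) (r i) \<subseteq> ball (c j) (5 * r j)"
    by (rule Vitali_covering_lemma_cballs_balls[of K r "S / l" c]) (use r_bound in blast)+
  define J where "J = (\<lambda>(x, k). {x + t k ..< x + t k + v k})"
  define L where "L = (\<lambda>(x::real, k). (5 + 3 / \<alpha>) * v k)"
  define P where "P = (\<lambda>(x, k). {y. (x + t k) - y \<in> section_at (L (x, k))})"
  have J_sub: "J j \<subseteq> cball (c j) (r j)" for j
    by (cases j) (auto simp: J_def c_def r_def dist_real_def abs_le_iff field_simps)
  have [measurable]: "J j \<in> sets borel" for j by (cases j) (simp add: J_def)
  have [measurable]: "P j \<in> sets borel" for j
    by (cases j) (simp add: P_def)
  have E_sub: "fst ` K \<subseteq> (\<Union>j\<in>C. P j)"
  proof
    fix x assume "x \<in> fst ` K"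
    then obtain k where "(x, k) \<in> K" by auto
    then obtain x' k' where j: "(x', k') \<in> C"
      and sub: "cball (c (x, k)) (r (x, k)) \<subseteq> ball (c (x', k')) (5 * r (x', k'))"
      using cover[of "(x, k)"] by (metis surj_pair)
    have vk: "0 < v k" "0 < v k'" using v_pos by auto
    \<comment> \<open>Both endpoints of the swallowed interval lie in the fivefold enlargement: the left one bounds the distance of the left endpoints, and the two together bound the length.\<close>
    have "x + t k \<in> cball (c (x, k)) (r (x, k))" "x + t k + v k \<in> cball (c (x, k)) (r (x, k))"
      using vk by (auto simp: c_def r_def dist_real_def)
    with sub have "x + t k \<in> ball (c (x', k')) (5 * r (x', k'))"
      "x + t k + v k \<in> ball (c (x', k')) (5 * r (x', k'))" by blast+
    then have "\<bar>(x' + t k' + v k' / 2) - (x + t k)\<bar> < 5 * (v k' / 2)"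
      "\<bar>(x' + t k' + v k' / 2) - (x + t k + v k)\<bar> < 5 * (v k' / 2)"
      by (simp_all add: c_def r_def dist_real_def)
    then have "\<bar>(x' + t k') - (x + t k)\<bar> \<le> 3 * v k'" "v k \<le> 5 * v k'"
      using vk unfolding abs_less_iff abs_le_iff by linarith+
    moreover have "\<alpha> * (L (x', k') - v k) = 3 * v k' + \<alpha> * (5 * v k' - v k)"
      using \<alpha>_pos by (simp add: L_def field_simps)
    ultimately have "\<bar>(x' + t k') - x - t k\<bar> \<le> \<alpha> * (L (x', k') - v k)"
      using \<alpha>_pos by (simp add: diff_diff_eq add_increasing2)
    moreover have "0 < L (x', k')" using vk \<alpha>_pos by (simp add: L_def add_pos_pos)
    ultimately have "(x' + t k') - x \<in> section_at (L (x', k'))"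
      unfolding mem_section_at by blast
    then show "x \<in> (\<Union>j\<in>C. P j)" using j by (force simp: P_def)
  qed
  have "emeasure lborel (fst ` K) \<le> emeasure lborel (\<Union>j\<in>C. P j)"
    using C(1) by (intro emeasure_mono E_sub) (auto intro!: sets.countable_UN')
  also have "\<dots> = (\<integral>\<^sup>+ y. indicator (\<Union>j\<in>C. P j) y \<partial>lborel)"
    using C(1) by (subst nn_integral_indicator) (auto intro!: sets.countable_UN')
  also have "\<dots> \<le> (\<integral>\<^sup>+ y. \<integral>\<^sup>+ j. indicator (P j) y \<partial>count_space C \<partial>lborel)"
  proof (intro nn_integral_mono)
    fix y
    show "indicator (\<Union>j\<in>C. P j) y \<le> (\<integral>\<^sup>+ j. indicator (P j) y \<partial>count_space C)"
    proof (cases "y \<in> (\<Union>j\<in>C. P j)")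
      case True
      then obtain j where "j \<in> C" "y \<in> P j" by auto
      then show ?thesis
        using nn_integral_ge_point[of j C "\<lambda>j. indicator (P j) y :: ennreal"] True by simp
    qed simp
  qed
  also have "\<dots> = (\<integral>\<^sup>+ j. emeasure lborel (P j) \<partial>count_space C)"
    using C(1) by (subst nn_integral_count_space_nn_integral) auto
  also have "\<dots> \<le> (\<integral>\<^sup>+ j. ennreal (weak_const / l) * (\<integral>\<^sup>+ y. F y * indicator (J j) y \<partial>lborel) \<partial>count_space C)"
  proof (intro nn_integral_mono, simp)
    fix j assume "j \<in> C"
    then obtain x k where j: "j = (x, k)" and K: "(x, k) \<in> K" using C(2) by (cases j) auto
    have "emeasure lborel (P j) \<le> ennreal (A * L j)"
      unfolding j P_def prod.case using v_pos[of k] \<alpha>_pos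
      by (intro emeasure_reflected_section) (simp add: L_def add_pos_pos)
    also have "A * L j = (weak_const / l) * (l * v k)"
      using l by (simp add: j L_def weak_const_def)
    also have "ennreal \<dots> = ennreal (weak_const / l) * ennreal (l * v k)"
      using l v_pos[of k] weak_const_pos by (intro ennreal_mult) auto
    also have "\<dots> \<le> ennreal (weak_const / l) * (\<integral>\<^sup>+ y. F y * indicator (J j) y \<partial>lborel)"
      using K by (intro mult_left_mono) (auto simp: K_def j J_def)
    finally show "emeasure lborel (P j) \<le> ennreal (weak_const / l) * (\<integral>\<^sup>+ y. F y * indicator (J j) y \<partial>lborel)" .
  qed
  also have "\<dots> = ennreal (weak_const / l) * (\<integral>\<^sup>+ y. \<integral>\<^sup>+ j. F y * indicator (J j) y \<partial>count_space C \<partial>lborel)"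
    using C(1) by (subst nn_integral_count_space_nn_integral) (auto simp: nn_integral_cmult)
  also have "\<dots> \<le> ennreal (weak_const / l) * (\<integral>\<^sup>+ y. F y \<partial>lborel)"
  proof (intro mult_left_mono nn_integral_mono)
    fix y
    show "(\<integral>\<^sup>+ j. F y * indicator (J j) y \<partial>count_space C) \<le> F y"
    proof (cases "\<exists>j\<in>C. y \<in> J j")
      case True
      then obtain j0 where j0: "j0 \<in> C" "y \<in> J j0" by auto
      have "indicator (J j) y = (indicator {j0} j :: ennreal)" if "j \<in> C" for j
      proof (cases "j = j0")
        case False
        then have "disjnt (cball (c j) (r j)) (cball (c j0) (r j0))"
          using disj that j0 by (auto simp: pairwise_def)
        then have "y \<notin> J j" using J_sub[of j] J_sub[of j0] j0 unfolding disjnt_iff by blast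
        then show ?thesis using False by simp
      qed (use j0 in simp)
      then have "(\<integral>\<^sup>+ j. F y * indicator (J j) y \<partial>count_space C)
          = (\<integral>\<^sup>+ j. F y * indicator {j0} j \<partial>count_space C)"
        by (intro nn_integral_cong) simp
      also have "\<dots> = F y" using j0 by (simp add: nn_integral_cmult_indicator)
      finally show ?thesis by simp
    next
      case False
      then have "(\<integral>\<^sup>+ j. F y * indicator (J j) y \<partial>count_space C) = (\<integral>\<^sup>+ j. 0 \<partial>count_space C)"
        by (intro nn_integral_cong) (auto simp: indicator_def)
      then show ?thesis by simp
    qed
  qed simp
  finally show ?thesis unfolding E_eq .
qed

end

section \<open>Transference and interpolation for flows\<close>

locale line_flow = approach_region + sigma_finite_measure M
  for M :: "'a measure" +
  fixes V :: "real \<Rightarrow> 'a \<Rightarrow> 'a"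
  assumes flow_measurable: "(\<lambda>(\<tau>, x). V \<tau> x) \<in> measurable (borel \<Otimes>\<^sub>M M) M"
    and flow_add: "\<And>\<sigma> \<tau> x. x \<in> space M \<Longrightarrow> V (\<sigma> + \<tau>) x = V \<sigma> (V \<tau> x)"
    and flow_preserving: "\<And>\<tau>. distr M M (V \<tau>) = M"
begin

lemma flow_comp_measurable [measurable (raw)]:
  assumes "a \<in> borel_measurable N" "b \<in> measurable N M"
  shows "(\<lambda>z. V (a z) (b z)) \<in> measurable N M"
  using measurable_compose[OF measurable_Pair[OF assms] flow_measurable] by simp

lemma line_maximal_measurable [measurable]:
  assumes [measurable]: "g \<in> borel_measurable M"
  shows "line_maximal V t v g \<in> borel_measurable M"
  unfolding line_maximal_def by measurable

lemma nn_integral_flow: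
  assumes [measurable]: "g \<in> borel_measurable M"
  shows "(\<integral>\<^sup>+ x. g (V \<tau> x) \<partial>M) = (\<integral>\<^sup>+ x. g x \<partial>M)"
  by (subst (2) flow_preserving[of \<tau>, symmetric]) (simp add: nn_integral_distr)

text \<open>
  Calderon's transference.  The measure of \<open>E\<close> times \<open>R\<close> is the integral over the space of the time
  that an orbit spends in \<open>E\<close> during \<open>[0, R]\<close>.  Membership of the orbit in \<open>E\<close> at these times
  is decided by \<open>g\<close> along the orbit during \<open>[-R, 2 R]\<close>, so the inequality on the line bounds this
  time by the integral of \<open>g\<close> over three times as long a period.  The restriction to indices up to \<open>n\<close>
  is there to make \<open>R\<close> finite; the bound does not depend on \<open>n\<close>.
\<close>
lemma weak_type_flow_finite:
  fixes n :: nat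
  assumes [measurable]: "g \<in> borel_measurable M" and l: "0 < l"
  defines "E \<equiv> {x \<in> space M. \<exists>k\<le>n. ennreal (l * v k) <
      (\<integral>\<^sup>+ \<tau> \<in> {t k ..< t k + v k}. g (V \<tau> x) \<partial>lborel)}"
  shows "emeasure M E \<le> ennreal (3 * weak_const / l) * (\<integral>\<^sup>+ x. g x \<partial>M)"
proof -
  define R where "R = (\<Sum>k\<le>n. \<bar>t k\<bar> + v k)"
  have R_ge: "\<bar>t k\<bar> + v k \<le> R" if "k \<le> n" for k
    unfolding R_def using that v_pos
    by (intro member_le_sum) (auto intro: add_nonneg_nonneg simp: less_imp_le)
  have R_pos: "0 < R" using R_ge[of 0] v_pos[of 0] by simp
  have [measurable]: "E \<in> sets M" unfolding E_def by measurable
  have orbit: "(\<integral>\<^sup>+ \<sigma>. indicator E (V \<sigma> x) * indicator {0..R} \<sigma> \<partial>lborel)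
      \<le> ennreal (weak_const / l) * (\<integral>\<^sup>+ \<sigma>. g (V \<sigma> x) * indicator {-R..2*R} \<sigma> \<partial>lborel)"
    if x [measurable]: "x \<in> space M" for x
  proof -
    define F where "F \<sigma> = g (V \<sigma> x) * indicator {-R..2*R} \<sigma>" for \<sigma>
    have Fm [measurable]: "F \<in> borel_measurable borel" unfolding F_def by measurable
    define G where "G = {\<sigma>. ennreal l < line_maximal (\<lambda>\<tau> x. x + \<tau>) t v F \<sigma>}"
    have [measurable]: "G \<in> sets borel" unfolding G_def line_maximal_def by measurable
    have sub: "\<sigma> \<in> G" if \<sigma>: "\<sigma> \<in> {0..R}" and "V \<sigma> x \<in> E" for \<sigma>
    proof -
      from that obtain k where k: "k \<le> n"
        "ennreal (l * v k) < (\<integral>\<^sup>+ \<tau> \<in> {t k ..< t k + v k}. g (V \<tau> (V \<sigma> x)) \<partial>lborel)"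
        unfolding E_def by auto
      have "(\<integral>\<^sup>+ \<tau> \<in> {t k ..< t k + v k}. g (V \<tau> (V \<sigma> x)) \<partial>lborel)
          = (\<integral>\<^sup>+ \<tau> \<in> {t k ..< t k + v k}. F (\<sigma> + \<tau>) \<partial>lborel)"
        using \<sigma> R_ge[OF k(1)] v_pos[of k]
        by (intro nn_integral_cong) (auto simp: F_def indicator_def flow_add[OF x, symmetric] add.commute)
      then show ?thesis unfolding G_def using k(2) l v_pos
        by (auto simp: less_line_maximal_iff)
    qed
    have "(\<integral>\<^sup>+ \<sigma>. indicator E (V \<sigma> x) * indicator {0..R} \<sigma> \<partial>lborel) \<le> (\<integral>\<^sup>+ \<sigma>. indicator G \<sigma> \<partial>lborel)"
      using sub by (intro nn_integral_mono) (auto simp: indicator_def)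
    also have "\<dots> = emeasure lborel G" by simp
    also have "\<dots> \<le> ennreal (weak_const / l) * (\<integral>\<^sup>+ \<sigma>. F \<sigma> \<partial>lborel)"
      unfolding G_def using l by (intro weak_type_translation) auto
    finally show ?thesis by (simp add: F_def)
  qed
  interpret pair: pair_sigma_finite M lborel by unfold_locales
  have "ennreal R * emeasure M E = (\<integral>\<^sup>+ \<sigma>. emeasure M E * indicator {0..R} \<sigma> \<partial>lborel)"
    using R_pos by (simp add: nn_integral_cmult_indicator mult.commute)
  also have "\<dots> = (\<integral>\<^sup>+ \<sigma>. (\<integral>\<^sup>+ x. indicator E (V \<sigma> x) * indicator {0..R} \<sigma> \<partial>M) \<partial>lborel)"
    by (intro nn_integral_cong) (simp add: nn_integral_multc nn_integral_flow)
  also have "\<dots> = (\<integral>\<^sup>+ x. (\<integral>\<^sup>+ \<sigma>. indicator E (V \<sigma> x) * indicator {0..R} \<sigma> \<partial>lborel) \<partial>M)"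
    by (intro pair.Fubini') measurable
  also have "\<dots> \<le> (\<integral>\<^sup>+ x. ennreal (weak_const / l) *
      (\<integral>\<^sup>+ \<sigma>. g (V \<sigma> x) * indicator {-R..2*R} \<sigma> \<partial>lborel) \<partial>M)"
    by (intro nn_integral_mono orbit)
  also have "\<dots> = ennreal (weak_const / l) *
      (\<integral>\<^sup>+ x. (\<integral>\<^sup>+ \<sigma>. g (V \<sigma> x) * indicator {-R..2*R} \<sigma> \<partial>lborel) \<partial>M)"
    by (intro nn_integral_cmult) measurable
  also have "(\<integral>\<^sup>+ x. (\<integral>\<^sup>+ \<sigma>. g (V \<sigma> x) * indicator {-R..2*R} \<sigma> \<partial>lborel) \<partial>M)
      = (\<integral>\<^sup>+ \<sigma>. (\<integral>\<^sup>+ x. g (V \<sigma> x) * indicator {-R..2*R} \<sigma> \<partial>M) \<partial>lborel)"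
    by (intro pair.Fubini'[symmetric]) measurable
  also have "\<dots> = (\<integral>\<^sup>+ \<sigma>. (\<integral>\<^sup>+ x. g x \<partial>M) * indicator {-R..2*R} \<sigma> \<partial>lborel)"
    by (intro nn_integral_cong) (simp add: nn_integral_multc nn_integral_flow)
  also have "\<dots> = ennreal (3 * R) * (\<integral>\<^sup>+ x. g x \<partial>M)"
    using R_pos by (simp add: nn_integral_cmult_indicator mult.commute)
  finally have "ennreal (1 / R) * (ennreal R * emeasure M E)
      \<le> ennreal (1 / R) * (ennreal (weak_const / l) * (ennreal (3 * R) * (\<integral>\<^sup>+ x. g x \<partial>M)))"
    by (intro mult_left_mono) auto
  then show ?thesis
    using R_pos l weak_const_pos
    by (simp add: mult.assoc[symmetric] ennreal_mult[symmetric] mult.commute[of 3])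
qed

lemma weak_type_flow:
  assumes [measurable]: "g \<in> borel_measurable M" and l: "0 < l"
  shows "emeasure M {x \<in> space M. ennreal l < line_maximal V t v g x}
    \<le> ennreal (3 * weak_const / l) * (\<integral>\<^sup>+ x. g x \<partial>M)"
proof -
  define E where "E n = {x \<in> space M. \<exists>k\<le>n. ennreal (l * v k) <
      (\<integral>\<^sup>+ \<tau> \<in> {t k ..< t k + v k}. g (V \<tau> x) \<partial>lborel)}" for n
  have "{x \<in> space M. ennreal l < line_maximal V t v g x} = (\<Union>n. E n)"
    using l v_pos by (auto simp: E_def less_line_maximal_iff)
  also have "emeasure M \<dots> = (SUP n. emeasure M (E n))"
  proof (rule SUP_emeasure_incseq[symmetric])
    show "range E \<subseteq> sets M" unfolding E_def by auto
    show "incseq E"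
      unfolding incseq_def E_def by (blast intro: order_trans)
  qed
  also have "\<dots> \<le> ennreal (3 * weak_const / l) * (\<integral>\<^sup>+ x. g x \<partial>M)"
    unfolding E_def by (intro SUP_least weak_type_flow_finite l assms)
  finally show ?thesis .
qed

lemma line_maximal_truncate:
  assumes [measurable]: "g \<in> borel_measurable M" and x [measurable]: "x \<in> space M" and l: "0 < l"
  shows "line_maximal V t v g x
    \<le> line_maximal V t v (\<lambda>x. g x * indicator {x. ennreal l < g x} x) x + ennreal l"
  unfolding line_maximal_def
proof (rule SUP_least)
  fix k
  let ?h = "\<lambda>x. g x * indicator {x. ennreal l < g x} x"
  let ?J = "{t k ..< t k + v k}"
  have "(\<integral>\<^sup>+ \<tau> \<in> ?J. g (V \<tau> x) \<partial>lborel) \<le> (\<integral>\<^sup>+ \<tau>. ?h (V \<tau> x) * indicator ?J \<tau> + ennreal l * indicator ?J \<tau> \<partial>lborel)"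
    by (intro nn_integral_mono) (auto simp: indicator_def)
  also have "\<dots> = (\<integral>\<^sup>+ \<tau> \<in> ?J. ?h (V \<tau> x) \<partial>lborel) + ennreal l * ennreal (v k)"
    using v_pos[of k] by (subst nn_integral_add) (auto simp: nn_integral_cmult_indicator)
  finally have "ennreal (1 / v k) * (\<integral>\<^sup>+ \<tau> \<in> ?J. g (V \<tau> x) \<partial>lborel)
      \<le> ennreal (1 / v k) * ((\<integral>\<^sup>+ \<tau> \<in> ?J. ?h (V \<tau> x) \<partial>lborel) + ennreal l * ennreal (v k))"
    by (intro mult_left_mono) auto
  also have "\<dots> = ennreal (1 / v k) * (\<integral>\<^sup>+ \<tau> \<in> ?J. ?h (V \<tau> x) \<partial>lborel) + ennreal l"
    using v_pos[of k] l by (simp add: distrib_left ennreal_mult[symmetric])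
  also have "\<dots> \<le> (SUP k. ennreal (1 / v k) * (\<integral>\<^sup>+ \<tau> \<in> {t k ..< t k + v k}. ?h (V \<tau> x) \<partial>lborel)) + ennreal l"
    by (intro add_right_mono SUP_upper) auto
  finally show "ennreal (1 / v k) * (\<integral>\<^sup>+ \<tau> \<in> ?J. g (V \<tau> x) \<partial>lborel) \<le> \<dots>" .
qed

text \<open>
  The half of the interpolation that uses the trivial bound in \<open>L\<^sup>\<infinity>\<close>: where \<open>g \<le> l / 2\<close> it adds at
  most \<open>l / 2\<close> to the maximal function, so only the large values of \<open>g\<close> matter at level \<open>l\<close>.
\<close>
lemma weak_type_flow_truncated:
  assumes [measurable]: "g \<in> borel_measurable M" and l: "0 < l"
  shows "emeasure M {x \<in> space M. ennreal l < line_maximal V t v g x}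
    \<le> ennreal (6 * weak_const / l) * (\<integral>\<^sup>+ x. g x * indicator {x. ennreal (l / 2) < g x} x \<partial>M)"
proof -
  let ?h = "\<lambda>x. g x * indicator {x. ennreal (l / 2) < g x} x"
  have "ennreal (l / 2) < line_maximal V t v ?h x"
    if "x \<in> space M" "ennreal l < line_maximal V t v g x" for x
  proof (rule ccontr)
    assume "\<not> ennreal (l / 2) < line_maximal V t v ?h x"
    then have "line_maximal V t v ?h x + ennreal (l / 2) \<le> ennreal (l / 2) + ennreal (l / 2)"
      by (intro add_right_mono) simp
    also have "\<dots> = ennreal l" using l by (simp add: ennreal_plus[symmetric] del: ennreal_plus)
    finally show False
      using line_maximal_truncate[OF assms(1) that(1), of "l / 2"] that(2) l by auto
  qed
  then have "emeasure M {x \<in> space M. ennreal l < line_maximal V t v g x}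
     \<le> emeasure M {x \<in> space M. ennreal (l / 2) < line_maximal V t v ?h x}"
    by (intro emeasure_mono) auto
  also have "\<dots> \<le> ennreal (3 * weak_const / (l / 2)) * (\<integral>\<^sup>+ x. ?h x \<partial>M)"
    using l by (intro weak_type_flow) auto
  finally show ?thesis by simp
qed

text \<open>
  The preceding estimate multiplied by \<open>l powr (p - 1)\<close>, in the form that can be integrated over all
  real \<open>l\<close>: the indicators make both sides vanish for \<open>l \<le> 0\<close>.
\<close>
lemma weighted_distribution_flow:
  assumes [measurable]: "g \<in> borel_measurable M"
  shows "(\<integral>\<^sup>+ x. ennreal (l powr (p - 1)) * indicator {l. 0 < l \<and> ennreal l < line_maximal V t v g x} l \<partial>M)
    \<le> ennreal (6 * weak_const) * (\<integral>\<^sup>+ x. ennreal (l powr (p - 2)) * indicator {0<..} l *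
          (g x * indicator {x. ennreal (l / 2) < g x} x) \<partial>M)"
    (is "?lhs \<le> ennreal ?W * ?rhs")
proof (cases "0 < l")
  case True
  let ?N = "line_maximal V t v g"
  let ?I = "\<integral>\<^sup>+ x. g x * indicator {x. ennreal (l / 2) < g x} x \<partial>M"
  have "?lhs = (\<integral>\<^sup>+ x. ennreal (l powr (p - 1)) * indicator {x \<in> space M. ennreal l < ?N x} x \<partial>M)"
    using True by (intro nn_integral_cong) (auto simp: indicator_def)
  also have "\<dots> = ennreal (l powr (p - 1)) * emeasure M {x \<in> space M. ennreal l < ?N x}"
    by (intro nn_integral_cmult_indicator) measurable
  also have "\<dots> \<le> ennreal (l powr (p - 1)) * (ennreal (?W / l) * ?I)"
    using True by (intro mult_left_mono weak_type_flow_truncated) auto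
  also have "\<dots> = ennreal (l powr (p - 1) * (?W / l)) * ?I"
    using True weak_const_pos by (subst ennreal_mult) (auto simp: mult.assoc)
  also have "l powr (p - 1) * (?W / l) = ?W * l powr (p - 2)"
    using True powr_diff[of l "p - 1" 1] by simp
  also have "ennreal (?W * l powr (p - 2)) * ?I = ennreal ?W * (ennreal (l powr (p - 2)) * ?I)"
    using weak_const_pos by (simp add: ennreal_mult mult.assoc)
  also have "ennreal (l powr (p - 2)) * ?I = ?rhs"
    using True by (simp add: nn_integral_cmult)
  finally show ?thesis .
qed simp

text \<open>
  The interpolation: write the \<open>p\<close>-th power by layers, apply the estimate of each layer, and exchange
  the integrals, so that at each point the layers below \<open>2 g\<close> remain.
\<close>
lemma strong_type_flow:
  assumes [measurable]: "g \<in> borel_measurable M" and p: "1 < p"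
  shows "(\<integral>\<^sup>+ x. ennreal_powr (line_maximal V t v g x) p \<partial>M)
    \<le> ennreal (p * (6 * weak_const) * (2 powr (p - 1) / (p - 1))) * (\<integral>\<^sup>+ x. ennreal_powr (g x) p \<partial>M)"
proof -
  let ?N = "line_maximal V t v g"
  let ?W = "6 * weak_const"
  let ?c = "2 powr (p - 1) / (p - 1)"
  let ?S = "\<integral>\<^sup>+ x. ennreal_powr (g x) p \<partial>M"
  let ?D = "\<lambda>l x. ennreal (l powr (p - 1)) * indicator {l. 0 < l \<and> ennreal l < ?N x} l"
  let ?T = "\<lambda>l x. ennreal (l powr (p - 2)) * indicator {0<..} l * (g x * indicator {x. ennreal (l / 2) < g x} x)"
  interpret pair: pair_sigma_finite M lborel by unfold_locales
  have D [measurable]: "(\<lambda>(x, l). ?D l x) \<in> borel_measurable (M \<Otimes>\<^sub>M borel)"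
    unfolding indicator_def by measurable
  have T [measurable]: "(\<lambda>(x, l). ?T l x) \<in> borel_measurable (M \<Otimes>\<^sub>M borel)"
    unfolding indicator_def by measurable
  have "(\<integral>\<^sup>+ x. ennreal_powr (?N x) p \<partial>M) = (\<integral>\<^sup>+ x. ennreal p * (\<integral>\<^sup>+ l. ?D l x \<partial>lborel) \<partial>M)"
    using p by (simp add: layer_cake)
  also have "\<dots> = ennreal p * (\<integral>\<^sup>+ x. (\<integral>\<^sup>+ l. ?D l x \<partial>lborel) \<partial>M)"
    using D by (intro nn_integral_cmult lborel.borel_measurable_nn_integral) (simp cong: measurable_cong_sets)
  also have "(\<integral>\<^sup>+ x. (\<integral>\<^sup>+ l. ?D l x \<partial>lborel) \<partial>M) = (\<integral>\<^sup>+ l. (\<integral>\<^sup>+ x. ?D l x \<partial>M) \<partial>lborel)"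
    using D by (intro pair.Fubini'[symmetric]) (simp add: case_prod_unfold cong: measurable_cong_sets)
  finally have eq: "(\<integral>\<^sup>+ x. ennreal_powr (?N x) p \<partial>M) = ennreal p * (\<integral>\<^sup>+ l. (\<integral>\<^sup>+ x. ?D l x \<partial>M) \<partial>lborel)" .
  have "(\<integral>\<^sup>+ l. (\<integral>\<^sup>+ x. ?D l x \<partial>M) \<partial>lborel) \<le> (\<integral>\<^sup>+ l. ennreal ?W * (\<integral>\<^sup>+ x. ?T l x \<partial>M) \<partial>lborel)"
    by (intro nn_integral_mono weighted_distribution_flow assms)
  also have "\<dots> = ennreal ?W * (\<integral>\<^sup>+ l. (\<integral>\<^sup>+ x. ?T l x \<partial>M) \<partial>lborel)"
    by (intro nn_integral_cmult) measurable
  also have "(\<integral>\<^sup>+ l. (\<integral>\<^sup>+ x. ?T l x \<partial>M) \<partial>lborel) = (\<integral>\<^sup>+ x. (\<integral>\<^sup>+ l. ?T l x \<partial>lborel) \<partial>M)"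
    using T by (intro pair.Fubini') (simp add: case_prod_unfold cong: measurable_cong_sets)
  finally have le: "(\<integral>\<^sup>+ l. (\<integral>\<^sup>+ x. ?D l x \<partial>M) \<partial>lborel) \<le> ennreal ?W * (\<integral>\<^sup>+ x. (\<integral>\<^sup>+ l. ?T l x \<partial>lborel) \<partial>M)" .
  have "(\<integral>\<^sup>+ x. (\<integral>\<^sup>+ l. ?T l x \<partial>lborel) \<partial>M) \<le> (\<integral>\<^sup>+ x. ennreal ?c * ennreal_powr (g x) p \<partial>M)"
    by (intro nn_integral_mono order_trans[OF _ truncated_layers_le[OF p]]) (simp add: indicator_def)
  also have "\<dots> = ennreal ?c * ?S"
    by (intro nn_integral_cmult) measurable
  finally have le': "(\<integral>\<^sup>+ x. (\<integral>\<^sup>+ l. ?T l x \<partial>lborel) \<partial>M) \<le> ennreal ?c * ?S" .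
  have "(\<integral>\<^sup>+ x. ennreal_powr (?N x) p \<partial>M) \<le> ennreal p * (ennreal ?W * (ennreal ?c * ?S))"
    unfolding eq by (intro mult_left_mono order_trans[OF le] le') auto
  also have "\<dots> = ennreal (p * ?W * ?c) * ?S"
    using p weak_const_pos by (simp add: ennreal_mult mult.assoc del: times_divide_eq_right)
  finally show ?thesis .
qed

end

section \<open>Iteration over the coordinate directions\<close>

lemma line_flow_of_direction:
  fixes U :: "real^'d \<Rightarrow> 'a \<Rightarrow> 'a"
  assumes flow: "measure_preserving_flow M U" and "sigma_finite_measure M"
    and "approach_region t v A \<alpha>"
  shows "line_flow t v A \<alpha> M (\<lambda>\<tau>. U (\<tau> *\<^sub>R b))"
proof -
  interpret approach_region t v A \<alpha> by fact
  interpret sigma_finite_measure M by fact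
  have U [measurable]: "(\<lambda>(t, x). U t x) \<in> measurable (borel \<Otimes>\<^sub>M M) M"
    using flow by (simp add: measure_preserving_flow_def)
  show ?thesis
  proof
    have "(\<lambda>z. (\<lambda>(t, x). U t x) (fst z *\<^sub>R b, snd z)) \<in> measurable (borel \<Otimes>\<^sub>M M) M"
      by (rule measurable_compose[OF _ U]) measurable
    then show "(\<lambda>(\<tau>, x). U (\<tau> *\<^sub>R b) x) \<in> measurable (borel \<Otimes>\<^sub>M M) M"
      by (simp add: case_prod_unfold)
  qed (use flow in \<open>auto simp: measure_preserving_flow_def scaleR_add_left\<close>)
qed

lemma nn_integral_le_line_maximal:
  assumes "0 < v k"
  shows "(\<integral>\<^sup>+ \<tau> \<in> {t k ..< t k + v k}. g (V \<tau> x) \<partial>lborel) \<le> ennreal (v k) * line_maximal V t v g x"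
proof -
  have "(\<integral>\<^sup>+ \<tau> \<in> {t k ..< t k + v k}. g (V \<tau> x) \<partial>lborel)
     = ennreal (v k) * (ennreal (1 / v k) * (\<integral>\<^sup>+ \<tau> \<in> {t k ..< t k + v k}. g (V \<tau> x) \<partial>lborel))"
    by (simp only: mult.left_commute[of "ennreal (v k)"] ennreal_inverse_mult_cancel[OF assms])
  also have "\<dots> \<le> ennreal (v k) * line_maximal V t v g x"
    unfolding line_maximal_def by (intro mult_left_mono SUP_upper) auto
  finally show ?thesis .
qed

text \<open>
  Induction on the set of directions: the innermost average, along the new direction \<open>b\<close>, is at most
  the maximal function of \<open>g\<close> along \<open>b\<close>, and this function takes the place of \<open>g\<close> in the remaining
  averages.  The dominating \<open>h\<close> works for all \<open>k\<close> simultaneously, because the index in each direction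
  is maximised separately.
\<close>
lemma iterated_average_dominated:
  fixes U :: "real^'d \<Rightarrow> 'a \<Rightarrow> 'a" and t v :: "real^'d \<Rightarrow> nat \<Rightarrow> real"
  assumes flow: "measure_preserving_flow M U" and sigma: "sigma_finite_measure M" and p: "1 < p"
    and "finite S"
    and region: "\<And>b. b \<in> S \<Longrightarrow> \<exists>A \<alpha>. approach_region (t b) (v b) A \<alpha>"
  shows "\<exists>C>0. \<forall>g\<in>borel_measurable M. \<exists>h\<in>borel_measurable M.
      (\<integral>\<^sup>+ x. ennreal_powr (h x) p \<partial>M) \<le> ennreal C * (\<integral>\<^sup>+ x. ennreal_powr (g x) p \<partial>M) \<and>
      (\<forall>x\<in>space M. \<forall>k.
        (\<integral>\<^sup>+ y. g (U (\<Sum>b\<in>S. y b *\<^sub>R b) x) * (\<Prod>b\<in>S. indicator {t b k ..< t b k + v b k} (y b))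
          \<partial>(\<Pi>\<^sub>M b\<in>S. lborel)) \<le> ennreal (\<Prod>b\<in>S. v b k) * h x)"
  using \<open>finite S\<close> region
proof (induction S rule: finite_induct)
  case empty
  show ?case
    using flow by (intro exI[of _ 1] conjI ballI, simp, rule_tac x = g in bexI)
      (auto simp: PiM_empty nn_integral_count_space_finite measure_preserving_flow_def)
next
  case (insert b S)
  interpret product_sigma_finite "\<lambda>b::real^'d. lborel :: real measure" by unfold_locales
  obtain C where C: "0 < C" and IH: "\<And>g. g \<in> borel_measurable M \<Longrightarrow> \<exists>h\<in>borel_measurable M.
      (\<integral>\<^sup>+ x. ennreal_powr (h x) p \<partial>M) \<le> ennreal C * (\<integral>\<^sup>+ x. ennreal_powr (g x) p \<partial>M) \<and>
      (\<forall>x\<in>space M. \<forall>k.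
        (\<integral>\<^sup>+ y. g (U (\<Sum>b\<in>S. y b *\<^sub>R b) x) * (\<Prod>b\<in>S. indicator {t b k ..< t b k + v b k} (y b))
          \<partial>(\<Pi>\<^sub>M b\<in>S. lborel)) \<le> ennreal (\<Prod>b\<in>S. v b k) * h x)"
    using insert.IH insert.prems by auto
  obtain A \<alpha> where "approach_region (t b) (v b) A \<alpha>" using insert.prems by blast
  then interpret line_flow "t b" "v b" A \<alpha> M "\<lambda>\<tau>. U (\<tau> *\<^sub>R b)"
    by (rule line_flow_of_direction[OF flow sigma])
  define D where "D = p * (6 * weak_const) * (2 powr (p - 1) / (p - 1))"
  have D: "0 < D" using p weak_const_pos by (simp add: D_def)
  have U: "(\<lambda>(t, x). U t x) \<in> measurable (borel \<Otimes>\<^sub>M M) M"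
    and U_add: "\<And>s t x. x \<in> space M \<Longrightarrow> U (s + t) x = U s (U t x)"
    and U_meas: "\<And>t. U t \<in> measurable M M"
    using flow by (auto simp: measure_preserving_flow_def)
  have U_comp [measurable (raw)]: "(\<lambda>z. U (a z) (c z)) \<in> measurable N M"
    if "a \<in> borel_measurable N" "c \<in> measurable N M" for a c N
    using measurable_compose[OF measurable_Pair[OF that] U] by simp
  have "\<exists>h\<in>borel_measurable M.
      (\<integral>\<^sup>+ x. ennreal_powr (h x) p \<partial>M) \<le> ennreal (C * D) * (\<integral>\<^sup>+ x. ennreal_powr (g x) p \<partial>M) \<and>
      (\<forall>x\<in>space M. \<forall>k.
        (\<integral>\<^sup>+ y. g (U (\<Sum>b\<in>insert b S. y b *\<^sub>R b) x) *
            (\<Prod>b\<in>insert b S. indicator {t b k ..< t b k + v b k} (y b))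
          \<partial>(\<Pi>\<^sub>M b\<in>insert b S. lborel)) \<le> ennreal (\<Prod>b\<in>insert b S. v b k) * h x)"
    if g [measurable]: "g \<in> borel_measurable M" for g
  proof -
    define Ng where "Ng = line_maximal (\<lambda>\<tau>. U (\<tau> *\<^sub>R b)) (t b) (v b) g"
    have Ng [measurable]: "Ng \<in> borel_measurable M" unfolding Ng_def by measurable
    obtain h where h: "h \<in> borel_measurable M"
      and h_norm: "(\<integral>\<^sup>+ x. ennreal_powr (h x) p \<partial>M) \<le> ennreal C * (\<integral>\<^sup>+ x. ennreal_powr (Ng x) p \<partial>M)"
      and h_dom: "\<And>x k. x \<in> space M \<Longrightarrow>
        (\<integral>\<^sup>+ y. Ng (U (\<Sum>b\<in>S. y b *\<^sub>R b) x) * (\<Prod>b\<in>S. indicator {t b k ..< t b k + v b k} (y b))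
          \<partial>(\<Pi>\<^sub>M b\<in>S. lborel)) \<le> ennreal (\<Prod>b\<in>S. v b k) * h x"
      using IH[OF Ng] by auto
    show ?thesis
    proof (intro bexI[OF _ h] conjI ballI allI)
      have "(\<integral>\<^sup>+ x. ennreal_powr (Ng x) p \<partial>M) \<le> ennreal D * (\<integral>\<^sup>+ x. ennreal_powr (g x) p \<partial>M)"
        unfolding Ng_def D_def by (rule strong_type_flow[OF g p])
      then have "(\<integral>\<^sup>+ x. ennreal_powr (h x) p \<partial>M) \<le> ennreal C * (ennreal D * (\<integral>\<^sup>+ x. ennreal_powr (g x) p \<partial>M))"
        by (intro order_trans[OF h_norm] mult_left_mono) auto
      then show "(\<integral>\<^sup>+ x. ennreal_powr (h x) p \<partial>M) \<le> ennreal (C * D) * (\<integral>\<^sup>+ x. ennreal_powr (g x) p \<partial>M)"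
        using C D by (simp add: ennreal_mult mult.assoc)
    next
      fix x k assume x [measurable]: "x \<in> space M"
      let ?J = "\<lambda>b. {t b k ..< t b k + v b k}"
      let ?P = "\<lambda>z. \<Prod>c\<in>S. indicator (?J c) (z c) :: ennreal"
      let ?u = "\<lambda>z. \<Sum>c\<in>S. z c *\<^sub>R c"
      have "(\<integral>\<^sup>+ y. g (U (\<Sum>b\<in>insert b S. y b *\<^sub>R b) x) * (\<Prod>b\<in>insert b S. indicator (?J b) (y b))
          \<partial>(\<Pi>\<^sub>M b\<in>insert b S. lborel))
        = (\<integral>\<^sup>+ z. (\<integral>\<^sup>+ \<tau>. g (U (\<Sum>c\<in>insert b S. (z(b := \<tau>)) c *\<^sub>R c) x) *
              (\<Prod>c\<in>insert b S. indicator (?J c) ((z(b := \<tau>)) c)) \<partial>lborel) \<partial>(\<Pi>\<^sub>M b\<in>S. lborel))"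
        using insert.hyps by (intro product_nn_integral_insert) measurable
      also have "\<dots> = (\<integral>\<^sup>+ z. (\<integral>\<^sup>+ \<tau>. (g (U (\<tau> *\<^sub>R b) (U (?u z) x)) * indicator (?J b) \<tau>) * ?P z \<partial>lborel)
          \<partial>(\<Pi>\<^sub>M b\<in>S. lborel))"
      proof (intro nn_integral_cong)
        fix z \<tau>
        have "(\<Sum>c\<in>S. (z(b := \<tau>)) c *\<^sub>R c) = ?u z" "(\<Prod>c\<in>S. indicator (?J c) ((z(b := \<tau>)) c)) = ?P z"
          using insert.hyps by (auto intro!: sum.cong prod.cong)
        then show "g (U (\<Sum>c\<in>insert b S. (z(b := \<tau>)) c *\<^sub>R c) x) *
              (\<Prod>c\<in>insert b S. indicator (?J c) ((z(b := \<tau>)) c))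
            = (g (U (\<tau> *\<^sub>R b) (U (?u z) x)) * indicator (?J b) \<tau>) * ?P z"
          using insert.hyps x by (simp add: U_add mult.assoc)
      qed
      also have "\<dots> = (\<integral>\<^sup>+ z. (\<integral>\<^sup>+ \<tau> \<in> ?J b. g (U (\<tau> *\<^sub>R b) (U (?u z) x)) \<partial>lborel) * ?P z
          \<partial>(\<Pi>\<^sub>M b\<in>S. lborel))"
        using measurable_space[OF U_meas x]
        by (intro nn_integral_cong nn_integral_multc) measurable
      also have "\<dots> \<le> (\<integral>\<^sup>+ z. ennreal (v b k) * (Ng (U (?u z) x) * ?P z) \<partial>(\<Pi>\<^sub>M b\<in>S. lborel))"
        unfolding Ng_def mult.assoc[symmetric] using v_pos[of k]
        by (intro nn_integral_mono mult_right_mono nn_integral_le_line_maximal) auto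
      also have "\<dots> = ennreal (v b k) * (\<integral>\<^sup>+ z. Ng (U (?u z) x) * ?P z \<partial>(\<Pi>\<^sub>M b\<in>S. lborel))"
        by (intro nn_integral_cmult) measurable
      also have "\<dots> \<le> ennreal (v b k) * (ennreal (\<Prod>b\<in>S. v b k) * h x)"
        by (intro mult_left_mono h_dom x) auto
      also have "\<dots> = ennreal (v b k * (\<Prod>b\<in>S. v b k)) * h x"
        using v_pos[of k] by (simp add: ennreal_mult' mult.assoc)
      also have "v b k * (\<Prod>b\<in>S. v b k) = (\<Prod>b\<in>insert b S. v b k)"
        using insert.hyps by simp
      finally show "(\<integral>\<^sup>+ y. g (U (\<Sum>b\<in>insert b S. y b *\<^sub>R b) x) *
            (\<Prod>b\<in>insert b S. indicator (?J b) (y b))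
          \<partial>(\<Pi>\<^sub>M b\<in>insert b S. lborel)) \<le> ennreal (\<Prod>b\<in>insert b S. v b k) * h x" .
    qed
  qed
  then show ?case using C D by (intro exI[of _ "C * D"]) auto
qed

lemma nn_integral_half_open_box:
  fixes G :: "real^'d \<Rightarrow> ennreal" and w s :: "real^'d"
  assumes [measurable]: "G \<in> borel_measurable borel"
  shows "(\<integral>\<^sup>+ \<tau> \<in> half_open_box w s. G \<tau> \<partial>lborel)
    = (\<integral>\<^sup>+ y. G (\<Sum>b\<in>Basis. y b *\<^sub>R b) *
        (\<Prod>b\<in>Basis. indicator {w \<bullet> b ..< w \<bullet> b + s \<bullet> b} (y b)) \<partial>(\<Pi>\<^sub>M b\<in>Basis. lborel))"
proof -
  have box: "indicator (half_open_box w s) \<tau> = (\<Prod>b\<in>Basis. indicator {w \<bullet> b ..< w \<bullet> b + s \<bullet> b} (\<tau> \<bullet> b) :: ennreal)" for \<tau>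
  proof -
    have "(\<Prod>b\<in>Basis. indicator {w \<bullet> b ..< w \<bullet> b + s \<bullet> b} (\<tau> \<bullet> b) :: ennreal)
       = (if \<forall>b\<in>Basis. \<tau> \<bullet> b \<in> {w \<bullet> b ..< w \<bullet> b + s \<bullet> b} then 1 else 0)"
    proof (cases "\<forall>b\<in>Basis. \<tau> \<bullet> b \<in> {w \<bullet> b ..< w \<bullet> b + s \<bullet> b}")
      case False
      then obtain b where "b \<in> Basis" "\<tau> \<bullet> b \<notin> {w \<bullet> b ..< w \<bullet> b + s \<bullet> b}" by blast
      then show ?thesis using False by (auto intro!: bexI[of _ b])
    qed simp
    moreover have "\<tau> \<in> half_open_box w s \<longleftrightarrow> (\<forall>b\<in>Basis. \<tau> \<bullet> b \<in> {w \<bullet> b ..< w \<bullet> b + s \<bullet> b})"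
      by (auto simp: half_open_box_def Basis_vec_def inner_axis)
    ultimately show ?thesis by (simp add: indicator_def)
  qed
  have "(\<integral>\<^sup>+ \<tau> \<in> half_open_box w s. G \<tau> \<partial>lborel)
    = (\<integral>\<^sup>+ y. G (\<Sum>b\<in>Basis. y b *\<^sub>R b) *
        (\<Prod>b\<in>Basis. indicator {w \<bullet> b ..< w \<bullet> b + s \<bullet> b} ((\<Sum>c\<in>Basis. y c *\<^sub>R c) \<bullet> b))
        \<partial>(\<Pi>\<^sub>M b\<in>Basis. lborel))"
    unfolding box by (subst lborel_eq, subst nn_integral_distr) measurable
  also have "\<dots> = (\<integral>\<^sup>+ y. G (\<Sum>b\<in>Basis. y b *\<^sub>R b) *
        (\<Prod>b\<in>Basis. indicator {w \<bullet> b ..< w \<bullet> b + s \<bullet> b} (y b)) \<partial>(\<Pi>\<^sub>M b\<in>Basis. lborel))"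
    by (intro nn_integral_cong arg_cong2[where f = "(*)"] prod.cong)
       (simp_all add: inner_sum_left_Basis)
  finally show ?thesis .
qed

lemma prod_coordinates_eq_prod_Basis:
  fixes s :: "real^'d"
  shows "(\<Prod>i\<in>UNIV. s $ i) = (\<Prod>b\<in>Basis. s \<bullet> b)"
proof -
  have Basis_eq: "(Basis :: (real^'d) set) = (\<lambda>i. axis i 1) ` UNIV" by (auto simp: Basis_vec_def)
  have inj: "inj (\<lambda>i. axis i 1 :: real^'d)" by (simp add: inj_on_def axis_eq_axis)
  have "(\<Prod>b\<in>Basis. s \<bullet> b) = (\<Prod>i\<in>UNIV. s \<bullet> axis i 1)"
    unfolding Basis_eq by (simp add: prod.reindex[OF inj])
  then show ?thesis by (simp add: inner_axis)
qed

lemma strong_type_of_integral_bound: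
  assumes p: "0 < p" and C: "0 < C"
    and meas: "\<And>f. f \<in> borel_measurable M \<Longrightarrow> T f \<in> borel_measurable M"
    and bound: "\<And>f. f \<in> borel_measurable M \<Longrightarrow>
      (\<integral>\<^sup>+ x. ennreal_powr (T f x) p \<partial>M) \<le> ennreal C * (\<integral>\<^sup>+ x. ennreal_powr (ennreal \<bar>f x\<bar>) p \<partial>M)"
  shows "strong_type M T p"
  unfolding strong_type_def
proof (intro exI conjI ballI)
  show "0 < C powr (1 / p)" using C by simp
  fix f assume "f \<in> Lp_space M p"
  then have f: "f \<in> borel_measurable M" by (simp add: Lp_space_def)
  show "T f \<in> borel_measurable M" by (rule meas[OF f])
  show "Lp_norm M p (T f) \<le> ennreal (C powr (1 / p)) * Lp_norm M p (\<lambda>x. ennreal \<bar>f x\<bar>)"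
    unfolding Lp_norm_def using p C ennreal_powr_mono[OF _ bound[OF f], of "1 / p"]
    by (simp add: ennreal_powr_mult)
qed

theorem theorem1p2:
  fixes M :: "'a measure"
    and U :: "real^'d \<Rightarrow> 'a \<Rightarrow> 'a"
    and w s :: "nat \<Rightarrow> real^'d"
  assumes "prob_space M"
    and "nonatomic M"
    and "measure_preserving_flow M U"
    and "\<And>k i. 0 < s k $ i"
    and "\<And>i. \<exists>A>0. \<exists>\<alpha>>0. \<forall>l>0.
           emeasure lborel (cross_section (Omega_cone \<alpha> (Omega w s i)) l) \<le> ennreal (A * l)"
  shows "\<forall>p>1. strong_type M (maximal_op U w s) p"
proof (intro allI impI)
  fix p :: real assume p: "1 < p"
  interpret prob_space M by fact
  have sigma: "sigma_finite_measure M" by unfold_locales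
  have U: "(\<lambda>(t, x). U t x) \<in> measurable (borel \<Otimes>\<^sub>M M) M"
    using assms(3) by (simp add: measure_preserving_flow_def)
  have U_comp [measurable (raw)]: "(\<lambda>z. U (a z) (c z)) \<in> measurable N M"
    if "a \<in> borel_measurable N" "c \<in> measurable N M" for a c and N :: "'n measure"
    using measurable_compose[OF measurable_Pair[OF that] U] by simp
  have region: "\<exists>A \<alpha>. approach_region (\<lambda>k. w k \<bullet> b) (\<lambda>k. s k \<bullet> b) A \<alpha>" if b: "b \<in> Basis" for b
  proof -
    obtain i where i: "b = axis i 1" using b by (auto simp: Basis_vec_def)
    obtain A \<alpha> where A: "0 < A" "0 < \<alpha>" "\<And>l. 0 < l \<Longrightarrow>
        emeasure lborel (cross_section (Omega_cone \<alpha> (Omega w s i)) l) \<le> ennreal (A * l)"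
      using assms(5)[of i] by blast
    have "Omega w s i = range (\<lambda>k. (w k \<bullet> b, s k \<bullet> b))"
      by (auto simp: Omega_def i inner_axis)
    then have "approach_region (\<lambda>k. w k \<bullet> b) (\<lambda>k. s k \<bullet> b) A \<alpha>"
      using A assms(4) by unfold_locales (simp_all add: i inner_axis)
    then show ?thesis by blast
  qed
  obtain C where C: "0 < C" and dom: "\<And>g. g \<in> borel_measurable M \<Longrightarrow> \<exists>h\<in>borel_measurable M.
      (\<integral>\<^sup>+ x. ennreal_powr (h x) p \<partial>M) \<le> ennreal C * (\<integral>\<^sup>+ x. ennreal_powr (g x) p \<partial>M) \<and>
      (\<forall>x\<in>space M. \<forall>k.
        (\<integral>\<^sup>+ y. g (U (\<Sum>b\<in>Basis. y b *\<^sub>R b) x) *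
            (\<Prod>b\<in>Basis. indicator {w k \<bullet> b ..< w k \<bullet> b + s k \<bullet> b} (y b))
          \<partial>(\<Pi>\<^sub>M b\<in>Basis. lborel)) \<le> ennreal (\<Prod>b\<in>Basis. s k \<bullet> b) * h x)"
    using iterated_average_dominated[where t = "\<lambda>b k. w k \<bullet> b" and v = "\<lambda>b k. s k \<bullet> b",
        OF assms(3) sigma p finite_Basis region] by blast
  show "strong_type M (maximal_op U w s) p"
  proof (rule strong_type_of_integral_bound[OF _ C])
    show "0 < p" using p by simp
    fix f :: "'a \<Rightarrow> real" assume f [measurable]: "f \<in> borel_measurable M"
    have [measurable]: "half_open_box (w k) (s k) \<in> sets borel" for k
      unfolding half_open_box_def by measurable
    show "maximal_op U w s f \<in> borel_measurable M"
      unfolding maximal_op_def by measurable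
    obtain h where h_norm: "(\<integral>\<^sup>+ x. ennreal_powr (h x) p \<partial>M)
        \<le> ennreal C * (\<integral>\<^sup>+ x. ennreal_powr (ennreal \<bar>f x\<bar>) p \<partial>M)"
      and h_dom: "\<And>x k. x \<in> space M \<Longrightarrow>
        (\<integral>\<^sup>+ y. ennreal \<bar>f (U (\<Sum>b\<in>Basis. y b *\<^sub>R b) x)\<bar> *
            (\<Prod>b\<in>Basis. indicator {w k \<bullet> b ..< w k \<bullet> b + s k \<bullet> b} (y b))
          \<partial>(\<Pi>\<^sub>M b\<in>Basis. lborel)) \<le> ennreal (\<Prod>b\<in>Basis. s k \<bullet> b) * h x"
      using dom[of "\<lambda>x. ennreal \<bar>f x\<bar>"] by auto
    have "maximal_op U w s f x \<le> h x" if x [measurable]: "x \<in> space M" for x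
      unfolding maximal_op_def
    proof (rule SUP_least)
      fix k
      let ?P = "\<Prod>i\<in>UNIV. s k $ i"
      have P: "0 < ?P" using assms(4) by (simp add: prod_pos)
      have "(\<integral>\<^sup>+ \<tau> \<in> half_open_box (w k) (s k). ennreal \<bar>f (U \<tau> x)\<bar> \<partial>lborel) \<le> ennreal ?P * h x"
        using h_dom[OF x, of k] by (subst nn_integral_half_open_box) (simp_all add: prod_coordinates_eq_prod_Basis)
      then have "ennreal (1 / ?P) * (\<integral>\<^sup>+ \<tau> \<in> half_open_box (w k) (s k). ennreal \<bar>f (U \<tau> x)\<bar> \<partial>lborel)
          \<le> ennreal (1 / ?P) * (ennreal ?P * h x)"
        by (intro mult_left_mono) auto
      also have "\<dots> = h x"
        using P by (rule ennreal_inverse_mult_cancel)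
      finally show "ennreal (1 / ?P) * (\<integral>\<^sup>+ \<tau> \<in> half_open_box (w k) (s k). ennreal \<bar>f (U \<tau> x)\<bar> \<partial>lborel) \<le> h x" .
    qed
    then have "(\<integral>\<^sup>+ x. ennreal_powr (maximal_op U w s f x) p \<partial>M) \<le> (\<integral>\<^sup>+ x. ennreal_powr (h x) p \<partial>M)"
      using p by (intro nn_integral_mono ennreal_powr_mono) auto
    also note h_norm
    finally show "(\<integral>\<^sup>+ x. ennreal_powr (maximal_op U w s f x) p \<partial>M)
        \<le> ennreal C * (\<integral>\<^sup>+ x. ennreal_powr (ennreal \<bar>f x\<bar>) p \<partial>M)" .
  qed
qed

end
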